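(* Let $\mathbf{W}^*$ be the category of Archimedean $\ell$-groups with distinguished strong unit. For $(G,u)\in\mathbf{W}^*$, regarded as $G\le C(YG)$ via the Yosida representation: (a) $G\in(\mathrm{Y})$ if and only if $G(g)=I(Z(g))$ for all $g\in G$. (b) $G\in(\mathrm{CR})$ if and only if $I(Z(g))=g^{\perp\perp}$ for all $g\in G$. (c) Within $\mathbf{W}^*$, $(\mathrm{M})=(\mathrm{Y})\cap(\mathrm{CR})$; that is, $G\in(\mathrm{M})$ if and only if $G\in(\mathrm{Y})$ and $G\in(\mathrm{CR})$.
   Context: An ideal of an abelian $\ell$-group $G$ is a convex sub-$\ell$-group. For $g\in G$: $G(g)=\{f\in G : |f|\le n|g| \text{ for some positive integer } n\}$ is the principal ideal; $g^\perp=\{f\in G: |f|\wedge|g|=0\}$; for $S\subseteq G$, $S^\perp=\bigcap_{s\in S}s^\perp$; and $g^{\perp\perp}=(g^\perp)^\perp$. $(G,u)\in\mathbf{W}^*$ means $G$ is an Archimedean $\ell$-group and $u\ge 0$ in $G$ is a strong unit, i.e. $G(u)=G$. $YG=Y(G,u)$ is the set of ideals of $G$ maximal with respect to not containing $u$ (these are the proper maximal ideals), with the hull-kernel topology; it is compact Hausdorff. For $M\in YG$ there is a unique embedding $G/M\to\mathbb{R}$ of $\ell$-groups taking $u+M$ to $1$, and $g(M)$ denotes the image of $g+M$; this gives the (Yosida) embedding $G\le C(YG)$ with $u\mapsto 1$, whose image $0$-$1$ separates disjoint closed sets of $YG$. Then $\mathrm{coz}(g)=\{x\in YG: g(x)\ne0\}$,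 $Z(g)=YG\setminus\mathrm{coz}(g)$, and for closed $S\subseteq YG$, $I(S)=\{g\in G: Z(g)\supseteq S\}$. A subset $S$ of a space is regular open if $S=\mathrm{int}\,\mathrm{cl}\,S$. Classes: $(\mathrm{M})$: $G(g)=g^{\perp\perp}$ for all $g\in G$. $(\mathrm{Y})$: for all $g\in G$, $G(g)$ is an intersection of maximal ideals (the empty intersection being $G$). $(\mathrm{CR})$: for all $g\in G$, $\mathrm{coz}(g)$ is regular open in $YG$. *)

theory Defs
  imports "HOL-Analysis.Analysis" "HOL-Library.Lattice_Algebras" "HOL-Library.Set_Algebras"
begin

text \<open>
  An abelian \<open>\<ell>\<close>-group \<open>G\<close> is a type of class \<open>lattice_ab_group_add_abs\<close>, where
  \<open>\<bar>g\<bar> = sup g (- g)\<close>.  Subsets of \<open>G\<close> are sets over that type and \<open>G\<close> itself is \<open>UNIV\<close>.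
\<close>

abbreviation nmult :: "nat \<Rightarrow> 'a::comm_monoid_add \<Rightarrow> 'a"
  where "nmult n g \<equiv> (\<Sum>i<n. g)"

definition l_ideal :: "'a::lattice_ab_group_add_abs set \<Rightarrow> bool" where
  "l_ideal I \<longleftrightarrow>
     0 \<in> I \<and> (\<forall>a\<in>I. - a \<in> I) \<and>
     (\<forall>a\<in>I. \<forall>b\<in>I. a + b \<in> I \<and> sup a b \<in> I \<and> inf a b \<in> I) \<and>
     (\<forall>a\<in>I. \<forall>b\<in>I. \<forall>x. a \<le> x \<and> x \<le> b \<longrightarrow> x \<in> I)"

definition principal_ideal :: "'a::lattice_ab_group_add_abs \<Rightarrow> 'a set" where
  "principal_ideal g = {f. \<exists>n>0. \<bar>f\<bar> \<le> nmult n \<bar>g\<bar>}"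

definition polar :: "'a::lattice_ab_group_add_abs \<Rightarrow> 'a set" where
  "polar g = {f. inf \<bar>f\<bar> \<bar>g\<bar> = 0}"

definition polar_set :: "'a::lattice_ab_group_add_abs set \<Rightarrow> 'a set" where
  "polar_set S = (\<Inter>s\<in>S. polar s)"

definition archimedean :: "'a::lattice_ab_group_add_abs itself \<Rightarrow> bool" where
  "archimedean _ \<longleftrightarrow>
     (\<forall>a b::'a. 0 \<le> a \<and> 0 \<le> b \<and> (\<forall>n. nmult n a \<le> b) \<longrightarrow> a = 0)"

definition strong_unit :: "'a::lattice_ab_group_add_abs \<Rightarrow> bool" where
  "strong_unit u \<longleftrightarrow> 0 \<le> u \<and> principal_ideal u = UNIV"

text \<open>\<open>W_star u\<close>: the type of \<open>u\<close>, with the distinguished element \<open>u\<close>, is an object of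
  \<open>\<^bold>W\<^sup>*\<close>.\<close>

definition W_star :: "'a::lattice_ab_group_add_abs \<Rightarrow> bool" where
  "W_star u \<longleftrightarrow> archimedean TYPE('a) \<and> strong_unit u"

definition maximal_ideal :: "'a::lattice_ab_group_add_abs set \<Rightarrow> bool" where
  "maximal_ideal M \<longleftrightarrow>
     l_ideal M \<and> M \<noteq> UNIV \<and> (\<forall>J. l_ideal J \<and> M \<subseteq> J \<longrightarrow> J = M \<or> J = UNIV)"

definition yosida_space :: "'a::lattice_ab_group_add_abs \<Rightarrow> 'a set set" where
  "yosida_space u =
     {M. l_ideal M \<and> u \<notin> M \<and> (\<forall>J. l_ideal J \<and> M \<subset> J \<longrightarrow> u \<in> J)}"

text \<open>The closed sets of the hull-kernel topology are the hulls
  \<open>{M. S \<subseteq> M}\<close> for \<open>S \<subseteq> G\<close>.  They do satisfy the axioms of a topology,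
  as \<open>openin_yosida_topology\<close> below shows.\<close>

definition yosida_topology :: "'a::lattice_ab_group_add_abs \<Rightarrow> 'a set topology" where
  "yosida_topology u = topology (\<lambda>U. \<exists>S. U = {M \<in> yosida_space u. \<not> S \<subseteq> M})"

text \<open>\<open>e\<close> is an embedding of \<open>\<ell>\<close>-groups of the quotient \<open>G/M\<close> into the reals that maps
  \<open>u + M\<close> to \<open>1\<close>.  Elements of \<open>G/M\<close> are cosets \<open>g +o M\<close>, with operations induced from \<open>G\<close>;
  the values of \<open>e\<close> on sets that are not cosets are irrelevant.\<close>

definition quotient_embedding ::
    "'a::lattice_ab_group_add_abs \<Rightarrow> 'a set \<Rightarrow> ('a set \<Rightarrow> real) \<Rightarrow> bool" where
  "quotient_embedding u M e \<longleftrightarrow>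
     inj_on e (range (\<lambda>g. g +o M)) \<and>
     (\<forall>f g. e ((f + g) +o M) = e (f +o M) + e (g +o M)) \<and>
     (\<forall>f g. e (sup f g +o M) = max (e (f +o M)) (e (g +o M))) \<and>
     (\<forall>f g. e (inf f g +o M) = min (e (f +o M)) (e (g +o M))) \<and>
     e (u +o M) = 1"

text \<open>The real number \<open>g(M)\<close>.\<close>

definition yosida_value :: "'a::lattice_ab_group_add_abs \<Rightarrow> 'a \<Rightarrow> 'a set \<Rightarrow> real" where
  "yosida_value u g M = (THE r. \<exists>e. quotient_embedding u M e \<and> r = e (g +o M))"

definition coz :: "'a::lattice_ab_group_add_abs \<Rightarrow> 'a \<Rightarrow> 'a set set" where
  "coz u g = {M \<in> yosida_space u. yosida_value u g M \<noteq> 0}"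

definition zero_set :: "'a::lattice_ab_group_add_abs \<Rightarrow> 'a \<Rightarrow> 'a set set" where
  "zero_set u g = yosida_space u - coz u g"

definition vanishing_ideal :: "'a::lattice_ab_group_add_abs \<Rightarrow> 'a set set \<Rightarrow> 'a set" where
  "vanishing_ideal u S = {g. S \<subseteq> zero_set u g}"

definition regular_openin :: "'b topology \<Rightarrow> 'b set \<Rightarrow> bool" where
  "regular_openin X S \<longleftrightarrow> S \<subseteq> topspace X \<and> S = X interior_of (X closure_of S)"

definition class_M :: "'a::lattice_ab_group_add_abs itself \<Rightarrow> bool" where
  "class_M _ \<longleftrightarrow> (\<forall>g::'a. principal_ideal g = polar_set (polar g))"

text \<open>In the next definition, \<open>\<Inter>{} = UNIV\<close> provides the convention on empty
  intersections.\<close>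

definition class_Y :: "'a::lattice_ab_group_add_abs itself \<Rightarrow> bool" where
  "class_Y _ \<longleftrightarrow>
     (\<forall>g::'a. \<exists>\<M>. (\<forall>M\<in>\<M>. maximal_ideal M) \<and> principal_ideal g = \<Inter>\<M>)"

definition class_CR :: "'a::lattice_ab_group_add_abs \<Rightarrow> bool" where
  "class_CR u \<longleftrightarrow> (\<forall>g. regular_openin (yosida_topology u) (coz u g))"

subsection \<open>The hull-kernel topology is a topology\<close>

lemma l_idealD:
  assumes "l_ideal I"
  shows "0 \<in> I" "a \<in> I \<Longrightarrow> - a \<in> I" "a \<in> I \<Longrightarrow> b \<in> I \<Longrightarrow> a + b \<in> I"
    "a \<in> I \<Longrightarrow> b \<in> I \<Longrightarrow> sup a b \<in> I" "a \<in> I \<Longrightarrow> b \<in> I \<Longrightarrow> inf a b \<in> I"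
    "a \<in> I \<Longrightarrow> b \<in> I \<Longrightarrow> a \<le> x \<Longrightarrow> x \<le> b \<Longrightarrow> x \<in> I"
  using assms unfolding l_ideal_def by blast+

lemma l_ideal_abs: "l_ideal I \<Longrightarrow> a \<in> I \<Longrightarrow> \<bar>a\<bar> \<in> I"
  by (simp add: abs_lattice l_idealD(2,4))

lemma l_ideal_abs_le:
  assumes "l_ideal I" "a \<in> I" "\<bar>x\<bar> \<le> a" shows "x \<in> I"
proof (rule l_idealD(6)[OF assms(1)])
  show "- a \<in> I" "a \<in> I" using assms by (auto intro: l_idealD(2))
  show "- a \<le> x" using assms(3) abs_ge_minus_self[of x]
    by (subst minus_le_iff) (rule order_trans)
  show "x \<le> a" using assms(3) abs_ge_self order_trans by blast
qed

lemma inf_add_le: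
  fixes x y z :: "'a::lattice_ab_group_add_abs"
  assumes "0 \<le> x" "0 \<le> y" "0 \<le> z"
  shows "inf x (y + z) \<le> inf x y + inf x z"
proof -
  have "inf x y + inf x z = inf (inf (x + x) (y + x)) (inf (x + z) (y + z))"
    by (simp add: add_inf_distrib_left add_inf_distrib_right)
  moreover have "x \<le> x + x" "x \<le> y + x" "x \<le> x + z" using assms by auto
  ultimately show ?thesis by (auto intro: le_infI1 le_infI2)
qed

lemma nmult_nonneg: "0 \<le> (x::'a::lattice_ab_group_add_abs) \<Longrightarrow> 0 \<le> nmult n x"
  by (rule sum_nonneg)

lemma inf_nmult_le:
  fixes x y :: "'a::lattice_ab_group_add_abs"
  assumes "0 \<le> x" "0 \<le> y"
  shows "inf x (nmult n y) \<le> nmult n (inf x y)"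
proof (induction n)
  case 0
  then show ?case using assms by (simp add: inf_absorb2)
next
  case (Suc n)
  have "inf x (nmult n y + y) \<le> inf x (nmult n y) + inf x y"
    by (intro inf_add_le assms nmult_nonneg)
  also have "\<dots> \<le> nmult n (inf x y) + inf x y" using Suc by simp
  finally show ?case by (simp del: sum_constant)
qed

lemma l_ideal_nmult: "l_ideal I \<Longrightarrow> a \<in> I \<Longrightarrow> nmult n a \<in> I"
  by (induction n) (auto simp: l_idealD(1,3) simp del: sum_constant)

lemma nmult_add: "nmult (m + n) x = nmult m x + nmult n (x::'a::lattice_ab_group_add_abs)"
  by (induction n) (auto simp: add_ac simp del: sum_constant)

lemma l_ideal_adjoin:
  fixes I :: "'a::lattice_ab_group_add_abs set"
  assumes I: "l_ideal I"
  shows "l_ideal {x. \<exists>m\<in>I. \<exists>n. \<bar>x\<bar> \<le> m + nmult n \<bar>s\<bar>}" (is "l_ideal ?J")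
proof -
  have sub: "c \<in> ?J" if ab: "a \<in> ?J" "b \<in> ?J" and c: "\<bar>c\<bar> \<le> \<bar>a\<bar> + \<bar>b\<bar>" for a b c
  proof -
    obtain m n m' n' where m: "m \<in> I" "m' \<in> I"
      and le: "\<bar>a\<bar> \<le> m + nmult n \<bar>s\<bar>" "\<bar>b\<bar> \<le> m' + nmult n' \<bar>s\<bar>"
      using ab by blast
    have "\<bar>c\<bar> \<le> (m + nmult n \<bar>s\<bar>) + (m' + nmult n' \<bar>s\<bar>)"
      using order_trans[OF c add_mono[OF le]] .
    also have "\<dots> = (m + m') + nmult (n + n') \<bar>s\<bar>"
      by (simp add: nmult_add add_ac del: sum_constant)
    finally show ?thesis using l_idealD(3)[OF I m] by blast
  qed
  have between: "\<bar>x\<bar> \<le> \<bar>a\<bar> + \<bar>b\<bar>" if "a \<le> x" "x \<le> b" for a b x :: 'a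
  proof (rule abs_leI)
    show "x \<le> \<bar>a\<bar> + \<bar>b\<bar>"
      using order_trans[OF that(2) abs_ge_self] by (rule add_increasing[OF abs_ge_zero])
    have "- x \<le> \<bar>a\<bar>" using that(1) abs_ge_minus_self[of a]
      by (meson neg_le_iff_le order_trans)
    then show "- x \<le> \<bar>a\<bar> + \<bar>b\<bar>" by (rule add_increasing2[OF abs_ge_zero])
  qed
  have 0: "0 \<in> ?J" using l_idealD(1)[OF I] by (auto intro!: bexI[of _ 0] exI[of _ 0])
  have si: "\<bar>sup a b\<bar> \<le> \<bar>a\<bar> + \<bar>b\<bar>" "\<bar>inf a b\<bar> \<le> \<bar>a\<bar> + \<bar>b\<bar>" for a b :: 'a
  proof -
    have ab: "a \<le> \<bar>a\<bar> + \<bar>b\<bar>" "b \<le> \<bar>a\<bar> + \<bar>b\<bar>" "- a \<le> \<bar>a\<bar> + \<bar>b\<bar>" "- b \<le> \<bar>a\<bar> + \<bar>b\<bar>"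
      by (auto intro: add_increasing add_increasing2 abs_ge_self abs_ge_minus_self)
    show "\<bar>sup a b\<bar> \<le> \<bar>a\<bar> + \<bar>b\<bar>" "\<bar>inf a b\<bar> \<le> \<bar>a\<bar> + \<bar>b\<bar>"
      using ab by (auto intro!: abs_leI le_infI1 simp: neg_sup_eq_inf neg_inf_eq_sup)
  qed
  show ?thesis
    unfolding l_ideal_def
  proof (intro conjI ballI allI impI)
    show "0 \<in> ?J" by (rule 0)
  next
    fix a assume "a \<in> ?J" then show "- a \<in> ?J" by simp
  next
    fix a b assume ab: "a \<in> ?J" "b \<in> ?J"
    show "a + b \<in> ?J" by (rule sub[OF ab abs_triangle_ineq])
    show "sup a b \<in> ?J" by (rule sub[OF ab si(1)])
    show "inf a b \<in> ?J" by (rule sub[OF ab si(2)])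
  next
    fix a b x assume ab: "a \<in> ?J" "b \<in> ?J" and "a \<le> x \<and> x \<le> b"
    then show "x \<in> ?J" using sub[OF ab between] by blast
  qed
qed

lemma yosida_space_prime:
  fixes u s t :: "'a::lattice_ab_group_add_abs"
  assumes M: "M \<in> yosida_space u" and st: "inf \<bar>s\<bar> \<bar>t\<bar> \<in> M"
  shows "s \<in> M \<or> t \<in> M"
proof (rule ccontr)
  assume "\<not> ?thesis"
  then have nst: "s \<notin> M" "t \<notin> M" by auto
  have I: "l_ideal M" and uM: "u \<notin> M"
    and max: "\<And>J. l_ideal J \<Longrightarrow> M \<subset> J \<Longrightarrow> u \<in> J"
    using M unfolding yosida_space_def by auto
  have key: "\<exists>m\<in>M. \<exists>n. \<bar>u\<bar> \<le> m + nmult n \<bar>r\<bar>" if r: "r \<notin> M" for r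
  proof -
    let ?J = "{x. \<exists>m\<in>M. \<exists>n. \<bar>x\<bar> \<le> m + nmult n \<bar>r\<bar>}"
    have "M \<subseteq> ?J"
      using l_ideal_abs[OF I] by (auto intro!: bexI exI[of _ 0] simp del: sum_constant)
    moreover have "r \<in> ?J"
      using l_idealD(1)[OF I] by (auto intro!: bexI[of _ 0] exI[of _ 1])
    ultimately have "M \<subset> ?J" using r by blast
    then show ?thesis using max[OF l_ideal_adjoin[OF I]] by blast
  qed
  obtain m n m' n' where m: "m \<in> M" "m' \<in> M"
    and le: "\<bar>u\<bar> \<le> m + nmult n \<bar>s\<bar>" "\<bar>u\<bar> \<le> m' + nmult n' \<bar>t\<bar>"
    using key[OF nst(1)] key[OF nst(2)] by blast
  let ?w = "sup m m'"
  let ?p = "nmult n \<bar>s\<bar>" and ?q = "nmult n' \<bar>t\<bar>"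
  have pq: "0 \<le> ?p" "0 \<le> ?q" by (intro nmult_nonneg abs_ge_zero)+
  have "\<bar>u\<bar> \<le> ?w + ?p" "\<bar>u\<bar> \<le> ?w + ?q"
    by (rule order_trans[OF le(1)] order_trans[OF le(2)], rule add_right_mono, simp)+
  then have u: "\<bar>u\<bar> \<le> ?w + inf ?p ?q" by (simp add: add_inf_distrib_left del: sum_constant)
  have "inf \<bar>t\<bar> ?p \<in> M"
  proof (rule l_ideal_abs_le[OF I])
    show "nmult n (inf \<bar>t\<bar> \<bar>s\<bar>) \<in> M" using l_ideal_nmult[OF I st] by (simp add: inf_commute)
    show "\<bar>inf \<bar>t\<bar> ?p\<bar> \<le> nmult n (inf \<bar>t\<bar> \<bar>s\<bar>)"
      using inf_nmult_le[of "\<bar>t\<bar>" "\<bar>s\<bar>" n] pq(1) by (simp del: sum_constant)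
  qed
  then have *: "nmult n' (inf ?p \<bar>t\<bar>) \<in> M" using l_ideal_nmult[OF I] by (simp add: inf_commute)
  have "inf ?p ?q \<le> nmult n' (inf ?p \<bar>t\<bar>)"
    by (rule inf_nmult_le[OF pq(1) abs_ge_zero])
  then have "\<bar>u\<bar> \<le> ?w + nmult n' (inf ?p \<bar>t\<bar>)"
    using u by (meson add_left_mono order_trans)
  then have "u \<in> M"
    using l_ideal_abs_le[OF I l_idealD(3)[OF I l_idealD(4)[OF I m] *]] by blast
  then show False using uM by blast
qed

lemma openin_yosida_topology:
  "openin (yosida_topology u) U \<longleftrightarrow> (\<exists>S. U = {M \<in> yosida_space u. \<not> S \<subseteq> M})"
proof -
  let ?P = "\<lambda>U. \<exists>S. U = {M \<in> yosida_space u. \<not> S \<subseteq> M}"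
  have "istopology ?P"
    unfolding istopology_def
  proof (intro conjI allI impI)
    fix A B assume "?P A" "?P B"
    then obtain S T where A: "A = {M \<in> yosida_space u. \<not> S \<subseteq> M}"
      and B: "B = {M \<in> yosida_space u. \<not> T \<subseteq> M}" by blast
    let ?R = "{inf \<bar>s\<bar> \<bar>t\<bar> | s t. s \<in> S \<and> t \<in> T}"
    have "(\<not> S \<subseteq> M \<and> \<not> T \<subseteq> M) \<longleftrightarrow> \<not> ?R \<subseteq> M" if M: "M \<in> yosida_space u" for M
    proof -
      have I: "l_ideal M" using M unfolding yosida_space_def by auto
      have "inf \<bar>s\<bar> \<bar>t\<bar> \<in> M" if "s \<in> M \<or> t \<in> M" for s t
      proof -
        have "\<bar>inf \<bar>s\<bar> \<bar>t\<bar>\<bar> = inf \<bar>s\<bar> \<bar>t\<bar>" by simp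
        then show ?thesis using that l_ideal_abs[OF I] l_ideal_abs_le[OF I]
          by (metis inf_le1 inf_le2)
      qed
      then show ?thesis using yosida_space_prime[OF M] by blast
    qed
    then have "A \<inter> B = {M \<in> yosida_space u. \<not> ?R \<subseteq> M}" unfolding A B by blast
    then show "?P (A \<inter> B)" by blast
  next
    fix \<K> assume "\<forall>K\<in>\<K>. ?P K"
    then obtain S where S: "\<forall>K\<in>\<K>. K = {M \<in> yosida_space u. \<not> S K \<subseteq> M}"
      by (rule bchoice[THEN exE])
    have "\<Union>\<K> = (\<Union>K\<in>\<K>. {M \<in> yosida_space u. \<not> S K \<subseteq> M})"
      using SUP_cong[of \<K> \<K> "\<lambda>K. K"] S by auto
    also have "\<dots> = {M \<in> yosida_space u. \<not> (\<Union>K\<in>\<K>. S K) \<subseteq> M}" by blast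
    finally have "\<Union>\<K> = {M \<in> yosida_space u. \<not> (\<Union>K\<in>\<K>. S K) \<subseteq> M}" .
    then show "?P (\<Union>\<K>)" by blast
  qed
  then show ?thesis unfolding yosida_topology_def by (simp add: topology_inverse')
qed

lemma topspace_yosida_topology: "topspace (yosida_topology u) = yosida_space u"
proof -
  have "yosida_space u = {M \<in> yosida_space u. \<not> UNIV \<subseteq> M}"
    unfolding yosida_space_def by blast
  then have "openin (yosida_topology u) (yosida_space u)"
    unfolding openin_yosida_topology by blast
  then show ?thesis
    unfolding topspace_def openin_yosida_topology by blast
qed

end

theory Submission
  imports Defs
begin

text \<open>
  For \<open>M\<close> in \<open>YG\<close> the quotient \<open>G/M\<close> is totally ordered and Archimedean, so a Hoelder cut
  construction gives its unique normalized embedding into the reals; hence \<open>g(M) = 0\<close> iff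
  \<open>g \<in> M\<close>, and \<open>I(Z(g))\<close> is the intersection of the members of \<open>YG\<close> containing \<open>g\<close>.
  Part (a) follows.  Since \<open>G\<close> is Archimedean, \<open>\<Inter>YG = 0\<close>, so \<open>f \<in> g\<^sup>\<bottom>\<close> iff \<open>coz f\<close> and \<open>coz g\<close>
  are disjoint.  As the cozero sets form a base, \<open>f \<in> g\<^sup>\<bottom>\<^sup>\<bottom>\<close> iff \<open>coz f \<subseteq> int cl (coz g)\<close>,
  which gives (b), and also the inclusions \<open>G(g) \<subseteq> I(Z(g)) \<subseteq> g\<^sup>\<bottom>\<^sup>\<bottom>\<close> behind (c).
\<close>

section \<open>Integer multiples in an abelian group\<close>

text \<open>At least one of the two natural multiples is zero. Integer coefficients are wanted
  because the numerators of cuts may be negative.\<close>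

definition zmult :: "int \<Rightarrow> 'a::ab_group_add \<Rightarrow> 'a" where
  "zmult k x = nmult (nat k) x - nmult (nat (- k)) x"

lemma zmult_simps [simp]: "zmult 0 x = 0" "zmult 1 x = x" "zmult (int n) x = nmult n x"
  by (simp_all add: zmult_def)

lemma zmult_Suc: "zmult (k + 1) x = zmult k x + x"
proof (cases "k \<ge> 0")
  case True
  then have "nat (k + 1) = Suc (nat k)" by simp
  with True show ?thesis by (simp add: zmult_def)
next
  case False
  then have "nat (- k) = Suc (nat (- (k + 1)))" by simp
  with False show ?thesis by (simp add: zmult_def)
qed

lemma zmult_pred: "zmult (k - 1) x = zmult k x - x"
  using zmult_Suc[of "k - 1" x] by (simp add: algebra_simps)

lemma zmult_add_left: "zmult (k + l) x = zmult k x + zmult l x"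
proof (induction l rule: int_induct[of _ 0])
  case (step1 i)
  then show ?case using zmult_Suc[of "k + i" x] zmult_Suc[of i x] by (simp add: algebra_simps)
next
  case (step2 i)
  have "zmult (k + (i - 1)) x = zmult (k + i) x - x"
    using zmult_pred[of "k + i" x] by (simp only: add_diff_eq)
  with step2 show ?case by (simp add: zmult_pred)
qed simp

lemma zmult_add_right: "zmult k (x + y) = zmult k x + zmult k y"
  by (induction k rule: int_induct[of _ 0]) (simp_all add: zmult_Suc zmult_pred algebra_simps)

lemma zmult_minus_left: "zmult (- k) x = - zmult k x"
  using zmult_add_left[of "- k" k x] by (simp add: eq_neg_iff_add_eq_0)

lemma zmult_diff_left: "zmult (k - l) x = zmult k x - zmult l x"
  using zmult_add_left[of k "- l" x] by (simp add: zmult_minus_left)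

lemma zmult_zero_right [simp]: "zmult k 0 = 0"
  by (simp add: zmult_def)

lemma zmult_minus_right: "zmult k (- x) = - zmult k x"
  using zmult_add_right[of k "- x" x] by (simp add: eq_neg_iff_add_eq_0)

lemma zmult_diff_right: "zmult k (x - y) = zmult k x - zmult k y"
  using zmult_add_right[of k x "- y"] by (simp add: zmult_minus_right)

lemma zmult_mult: "zmult (k * l) x = zmult k (zmult l x)"
  by (induction k rule: int_induct[of _ 0])
    (simp_all add: zmult_Suc zmult_pred zmult_add_left zmult_diff_left distrib_right left_diff_distrib)

lemma additive_zmult:
  fixes \<phi> :: "'a::ab_group_add \<Rightarrow> real"
  assumes "\<And>x y. \<phi> (x + y) = \<phi> x + \<phi> y"
  shows "\<phi> (zmult k x) = of_int k * \<phi> x"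
proof -
  interpret Modules.additive \<phi> by unfold_locales (rule assms)
  show ?thesis
    by (induction k rule: int_induct[of _ 0])
      (simp_all add: zero zmult_Suc zmult_pred add diff algebra_simps)
qed

section \<open>Hoelder's theorem: real values from a total Archimedean preorder\<close>

lemma rat_between:
  fixes a b :: real
  assumes "a < b"
  obtains k n :: int where "n > 0" "a < k / n" "k / n < b"
proof -
  obtain q where "a < of_rat q" "of_rat q < b" using of_rat_dense[OF assms] by blast
  moreover obtain k n where "q = Fract k n" "n > 0" by (cases q) auto
  ultimately show ?thesis using that[of n k] by (simp add: of_rat_rat)
qed

text \<open>\<open>P x\<close> means \<open>x \<le> 0\<close> in a total Archimedean preorder with strong unit \<open>u\<close>.\<close>

locale total_cone =
  fixes P :: "'a::ab_group_add \<Rightarrow> bool" and u :: 'a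
  assumes P_add: "P x \<Longrightarrow> P y \<Longrightarrow> P (x + y)"
    and P_total: "P x \<or> P (- x)"
    and P_unit: "\<exists>n. P (x - nmult n u)"
    and P_u: "\<not> P u"
    and P_arch: "\<not> P x \<Longrightarrow> \<exists>n. P (u - nmult n x)"
begin

lemma P_0: "P 0" using P_total[of 0] by simp

lemma P_nmult: "P x \<Longrightarrow> P (nmult n x)"
  by (induction n) (auto simp: P_0 intro: P_add)

lemma P_zmult: "P x \<Longrightarrow> 0 \<le> k \<Longrightarrow> P (zmult k x)"
  using P_nmult[of x "nat k"] by (simp add: zmult_def)

text \<open>Otherwise totality gives \<open>P (- x)\<close>, hence \<open>P\<close> of its multiple
  by k - 1; adding this to k x leaves \<open>x\<close> itself.\<close>

lemma P_zmult_cancel: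
  assumes "0 < k" "P (zmult k x)" shows "P x"
proof (rule ccontr)
  assume "\<not> P x"
  then have "P (zmult (k - 1) (- x))" using P_total assms by (intro P_zmult) auto
  from P_add[OF assms(2) this] have "P x"
    by (simp add: zmult_minus_right zmult_diff_left)
  with \<open>\<not> P x\<close> show False ..
qed

lemma P_zmult_u: "P (zmult k u) \<longleftrightarrow> k \<le> 0"
proof
  show "k \<le> 0" if "P (zmult k u)" using P_zmult_cancel[of k u] that P_u by fastforce
  have "P (- u)" using P_total P_u by blast
  then have "P (zmult (- k) (- u))" if "k \<le> 0" using that by (intro P_zmult) auto
  then show "P (zmult k u)" if "k \<le> 0" using that by (simp add: zmult_minus_left zmult_minus_right)
qed

text \<open>The rational upper bounds of \<open>x\<close> measured in units of \<open>u\<close>: the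
  condition reads n x \<le> k u. This is the upper half of a Dedekind cut.\<close>

definition cut :: "'a \<Rightarrow> real set" where
  "cut x = {of_int k / of_int n | k n. 0 < n \<and> P (zmult n x - zmult k u)}"

definition val :: "'a \<Rightarrow> real" where "val x = Inf (cut x)"

lemma cutI: "0 < n \<Longrightarrow> P (zmult n x - zmult k u) \<Longrightarrow> of_int k / of_int n \<in> cut x"
  unfolding cut_def by blast

text \<open>The two inequalities are brought to the common denominator m n and added.\<close>

lemma cut_add:
  assumes "a \<in> cut x" "b \<in> cut y" shows "a + b \<in> cut (x + y)"
proof -
  obtain k n l m where a: "a = of_int k / of_int n" "0 < n" "P (zmult n x - zmult k u)"
    and b: "b = of_int l / of_int m" "0 < m" "P (zmult m y - zmult l u)"
    using assms unfolding cut_def by blast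
  have "P (zmult m (zmult n x - zmult k u) + zmult n (zmult m y - zmult l u))"
    using a b by (intro P_add P_zmult) auto
  also have "zmult m (zmult n x - zmult k u) + zmult n (zmult m y - zmult l u) =
     zmult (m * n) (x + y) - zmult (m * k + n * l) u"
    by (simp add: zmult_diff_right zmult_add_right zmult_add_left mult.commute algebra_simps
        flip: zmult_mult)
  finally have "of_int (m * k + n * l) / of_int (m * n) \<in> cut (x + y)"
    using a b by (intro cutI) auto
  also have "of_int (m * k + n * l) / of_int (m * n) = a + b"
    using a b by (simp add: field_simps)
  finally show ?thesis .
qed

lemma cut_0_nonneg: "a \<in> cut 0 \<Longrightarrow> 0 \<le> a"
  unfolding cut_def by (auto simp: P_zmult_u simp flip: zmult_minus_left)

lemma cut_nonempty: "cut x \<noteq> {}"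
proof -
  obtain n where "P (x - nmult n u)" using P_unit by blast
  then have "of_int (int n) / of_int 1 \<in> cut x" by (intro cutI) auto
  then show ?thesis by blast
qed

text \<open>Any \<open>b\<close> in \<open>cut (- x)\<close> yields the lower bound - b, since a + b
  lies in \<open>cut 0\<close>.\<close>

lemma cut_bdd_below: "bdd_below (cut x)"
proof -
  obtain b where "b \<in> cut (- x)" using cut_nonempty by blast
  then have "- b \<le> a" if "a \<in> cut x" for a
    using cut_0_nonneg cut_add[OF that, of b "- x"] by fastforce
  then show ?thesis by (rule bdd_belowI)
qed

lemma val_le: "a \<in> cut x \<Longrightarrow> val x \<le> a"
  unfolding val_def by (rule cInf_lower[OF _ cut_bdd_below])

lemma val_ge: "(\<And>a. a \<in> cut x \<Longrightarrow> b \<le> a) \<Longrightarrow> b \<le> val x"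
  unfolding val_def by (rule cInf_greatest[OF cut_nonempty])

lemma val_subadd: "val (x + y) \<le> val x + val y"
proof -
  have "val (x + y) - a \<le> val y" if "a \<in> cut x" for a
  proof (rule val_ge)
    fix b assume "b \<in> cut y"
    from val_le[OF cut_add[OF that this]] show "val (x + y) - a \<le> b" by simp
  qed
  then have "val (x + y) - val y \<le> val x" by (intro val_ge) (metis diff_le_eq add.commute)
  then show ?thesis by simp
qed

text \<open>Totality enters here. If k/n lies strictly between \<open>- val x\<close> and
  \<open>val (- x)\<close>, then -k/n is too small to be in \<open>cut x\<close>, so totality puts
  k/n into \<open>cut (- x)\<close>, below its infimum.\<close>

lemma val_minus: "val (- x) = - val x"
proof (rule antisym)
  show "val (- x) \<le> - val x"
  proof (rule ccontr)
    assume "\<not> ?thesis"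
    then have "- val x < val (- x)" by simp
    then obtain k n :: int where kn: "n > 0" "- val x < k / n" "k / n < val (- x)"
      by (rule rat_between)
    have "of_int (- k) / of_int n \<notin> cut x" using val_le[of "of_int (- k) / of_int n" x] kn by auto
    then have "\<not> P (zmult n x - zmult (- k) u)" using cutI kn by blast
    then have "P (- (zmult n x - zmult (- k) u))" using P_total by blast
    then have "P (zmult n (- x) - zmult k u)"
      by (simp add: zmult_minus_left zmult_minus_right)
    from val_le[OF cutI[OF kn(1) this]] kn show False by simp
  qed
  have "0 \<le> val 0" by (rule val_ge) (rule cut_0_nonneg)
  then show "- val x \<le> val (- x)" using val_subadd[of x "- x"] by simp
qed

text \<open>Subadditivity at \<open>- x\<close> and \<open>- y\<close>, rewritten by
  \<open>val_minus\<close>, is the reverse inequality.\<close>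

lemma val_add: "val (x + y) = val x + val y"
  using val_subadd[of x y] val_subadd[of "- x" "- y"] val_minus[of "x + y"]
  by (simp add: val_minus)

lemma val_u: "val u = 1"
proof (rule antisym)
  show "val u \<le> 1" using val_le[OF cutI[of 1 u 1]] P_0 by simp
  show "1 \<le> val u"
    by (rule val_ge) (auto simp: cut_def P_zmult_u simp flip: zmult_diff_left)
qed

text \<open>The Archimedean property gives the direction from values to \<open>P\<close>: if
  \<open>P x\<close> fails, then u \<le> n x for some n, so 1 \<le> n \<open>val x\<close>, which
  excludes a nonpositive value.\<close>

lemma val_nonpos_iff: "val x \<le> 0 \<longleftrightarrow> P x"
proof
  show "val x \<le> 0" if "P x" for x using val_le[OF cutI[of 1 x 0]] that by simp
  note * = this
  show "P x" if "val x \<le> 0"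
  proof (rule ccontr)
    assume "\<not> P x"
    then obtain n where "P (u - zmult (int n) x)" using P_arch by auto
    from *[OF this] have "val u \<le> n * val x"
      using val_add[of "u - zmult (int n) x" "zmult (int n) x"]
        additive_zmult[of val "int n" x] val_add by simp
    moreover have "n * val x \<le> 0" using that by (simp add: mult_nonneg_nonpos)
    ultimately show False using val_u by simp
  qed
qed

text \<open>A rational k/n strictly between two differing values at \<open>x\<close> would make n x
  - k u nonpositive under one map and positive under the other, although \<open>P\<close> decides
  the sign for both.\<close>

lemma additive_unique:
  fixes \<phi> \<psi> :: "'a \<Rightarrow> real"
  assumes \<phi>: "\<And>x y. \<phi> (x + y) = \<phi> x + \<phi> y" "\<phi> u = 1" "\<And>x. \<phi> x \<le> 0 \<longleftrightarrow> P x"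
    and \<psi>: "\<And>x y. \<psi> (x + y) = \<psi> x + \<psi> y" "\<psi> u = 1" "\<And>x. \<psi> x \<le> 0 \<longleftrightarrow> P x"
  shows "\<phi> = \<psi>"
proof -
  \<comment> \<open>Stated for arbitrary maps because it is applied a second time with the roles
    exchanged.\<close>
  have le: "\<psi> x \<le> \<phi> x"
    if \<phi>: "\<And>x y. \<phi> (x + y) = \<phi> x + \<phi> y" "\<phi> u = 1" "\<And>x. \<phi> x \<le> 0 \<longleftrightarrow> P x"
    and \<psi>: "\<And>x y. \<psi> (x + y) = \<psi> x + \<psi> y" "\<psi> u = 1" "\<And>x. \<psi> x \<le> 0 \<longleftrightarrow> P x"
    for \<phi> \<psi> :: "'a \<Rightarrow> real" and x
  proof (rule ccontr)
    assume "\<not> ?thesis"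
    then have "\<phi> x < \<psi> x" by simp
    then obtain k n :: int where kn: "n > 0" "\<phi> x < k / n" "k / n < \<psi> x"
      by (rule rat_between)
    let ?y = "zmult n x + zmult (- k) u"
    have "\<phi> ?y = n * \<phi> x - k" "\<psi> ?y = n * \<psi> x - k"
      using \<phi> \<psi> additive_zmult[of \<phi>, OF \<phi>(1)] additive_zmult[of \<psi>, OF \<psi>(1)] by simp_all
    then have "\<phi> ?y \<le> 0" "\<not> \<psi> ?y \<le> 0" using kn by (simp_all add: field_simps)
    with \<phi>(3) \<psi>(3) show False by blast
  qed
  show ?thesis using le[OF \<phi> \<psi>] le[OF \<psi> \<phi>] by (intro ext antisym)
qed

end

section \<open>Positive parts, and ideals maximal without the unit\<close>

lemma pprt_add_le:
  fixes x y :: "'a::lattice_ab_group_add_abs"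
  shows "pprt (x + y) \<le> pprt x + pprt y"
  unfolding pprt_def by (rule sup_least) (auto intro: add_mono add_nonneg_nonneg)

lemma pprt_diff_pprt_uminus:
  fixes x :: "'a::lattice_ab_group_add_abs"
  shows "pprt x - pprt (- x) = x"
  using prts[of x] by (simp add: pprt_neg)

text \<open>Factoring \<open>pprt (- x)\<close> out of the infimum leaves the infimum of
  \<open>x\<close> and 0, which is \<open>- pprt (- x)\<close>.\<close>

lemma inf_pprt_uminus:
  fixes x :: "'a::lattice_ab_group_add_abs"
  shows "inf (pprt x) (pprt (- x)) = 0"
proof -
  have "inf (pprt x) (pprt (- x)) = pprt (- x) + inf (pprt x - pprt (- x)) 0"
    by (simp add: add_inf_distrib_left)
  then show ?thesis
    by (simp only: pprt_diff_pprt_uminus nprt_def[symmetric]) (simp add: pprt_neg)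
qed

lemma l_ideal_between_0:
  assumes "l_ideal I" "y \<in> I" "0 \<le> x" "x \<le> y" shows "x \<in> I"
  using l_idealD(6)[OF assms(1) l_idealD(1)[OF assms(1)] assms(2-4)] .

text \<open>Any two elements of the union lie in a common member of the chain. The predicate
  \<open>Q\<close> is arbitrary so that the lemma fits the family used with Zorn's lemma.\<close>

lemma l_ideal_Union_chain:
  assumes ch: "subset.chain {J. l_ideal J \<and> Q J} C" and ne: "C \<noteq> {}"
  shows "l_ideal (\<Union>C)"
proof -
  have I: "l_ideal J" if "J \<in> C" for J using ch that unfolding subset.chain_def by blast
  have two: "\<exists>J\<in>C. a \<in> J \<and> b \<in> J" if "a \<in> \<Union>C" "b \<in> \<Union>C" for a b
    using ch that unfolding subset.chain_def by blast
  show ?thesis unfolding l_ideal_def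
  proof (intro conjI ballI allI impI)
    show "0 \<in> \<Union>C" using ne I l_idealD(1) by blast
  next
    fix a assume "a \<in> \<Union>C" then show "- a \<in> \<Union>C" using I l_idealD(2) by blast
  next
    fix a b assume "a \<in> \<Union>C" "b \<in> \<Union>C"
    then obtain J where "J \<in> C" "a \<in> J" "b \<in> J" using two by blast
    then show "a + b \<in> \<Union>C" "sup a b \<in> \<Union>C" "inf a b \<in> \<Union>C" using I l_idealD(3-5) by blast+
  next
    fix a b x assume "a \<in> \<Union>C" "b \<in> \<Union>C" and x: "a \<le> x \<and> x \<le> b"
    then obtain J where "J \<in> C" "a \<in> J" "b \<in> J" using two by blast
    then show "x \<in> \<Union>C" using I x l_idealD(6) by blast
  qed
qed

text \<open>Zorn's lemma among the ideals that contain \<open>I\<close> and miss \<open>u\<close>.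
  An ideal properly above a maximal one still contains \<open>I\<close>, so it must contain
  \<open>u\<close>.\<close>

lemma ex_yosida_space_superset:
  assumes "l_ideal I" "u \<notin> I"
  obtains M where "M \<in> yosida_space u" "I \<subseteq> M"
proof -
  let ?A = "{J. l_ideal J \<and> I \<subseteq> J \<and> u \<notin> J}"
  have "\<exists>M\<in>?A. \<forall>X\<in>?A. M \<subseteq> X \<longrightarrow> X = M"
  proof (rule subset_Zorn_nonempty)
    show "?A \<noteq> {}" using assms by blast
    fix C assume ne: "C \<noteq> {}" and ch: "subset.chain ?A C"
    have "C \<subseteq> ?A" using ch unfolding subset.chain_def by blast
    with l_ideal_Union_chain[OF ch ne] ne show "\<Union>C \<in> ?A" by blast
  qed
  then obtain M where M: "M \<in> ?A" and max: "\<forall>X\<in>?A. M \<subseteq> X \<longrightarrow> X = M"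
    by (rule bexE)
  have "u \<in> J" if "l_ideal J" "M \<subset> J" for J
    using M max that by blast
  with M have "M \<in> yosida_space u" "I \<subseteq> M" unfolding yosida_space_def by simp_all
  then show ?thesis by (rule that)
qed

lemma l_ideal_zero: "l_ideal {0}"
  unfolding l_ideal_def by auto

text \<open>The ideal generated by \<open>M\<close> and \<open>r\<close> is properly larger than
  \<open>M\<close>, so it contains \<open>u\<close>.\<close>

lemma yosida_space_adjoin:
  assumes M: "M \<in> yosida_space u" and r: "r \<notin> M"
  obtains m n where "m \<in> M" "\<bar>u\<bar> \<le> m + nmult n \<bar>r\<bar>"
proof -
  let ?J = "{x. \<exists>m\<in>M. \<exists>n. \<bar>x\<bar> \<le> m + nmult n \<bar>r\<bar>}"
  have I: "l_ideal M" using M unfolding yosida_space_def by blast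
  have "M \<subseteq> ?J"
    using l_ideal_abs[OF I] by (auto intro!: bexI exI[of _ 0] simp del: sum_constant)
  moreover have "r \<in> ?J"
    using l_idealD(1)[OF I] by (auto intro!: bexI[of _ 0] exI[of _ 1])
  ultimately have "M \<subset> ?J" using r by blast
  then have "u \<in> ?J" using M l_ideal_adjoin[OF I] unfolding yosida_space_def by blast
  then show ?thesis using that by blast
qed

lemma yosida_spaceD: "M \<in> yosida_space u \<Longrightarrow> l_ideal M" "M \<in> yosida_space u \<Longrightarrow> u \<notin> M"
  unfolding yosida_space_def by blast+

lemma mem_iff_pprt:
  assumes I: "l_ideal M" shows "x \<in> M \<longleftrightarrow> pprt x \<in> M \<and> pprt (- x) \<in> M"
proof
  assume "x \<in> M"
  then show "pprt x \<in> M \<and> pprt (- x) \<in> M"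
    unfolding pprt_def using I by (simp add: l_idealD(1,2,4))
next
  assume "pprt x \<in> M \<and> pprt (- x) \<in> M"
  then have "pprt x + - pprt (- x) \<in> M" by (intro l_idealD(2,3) I) auto
  then show "x \<in> M" by (simp add: pprt_diff_pprt_uminus)
qed

lemma coset_eq_iff:
  assumes I: "l_ideal M" shows "f +o M = g +o M \<longleftrightarrow> f - g \<in> M"
proof
  assume "f +o M = g +o M"
  moreover have "f \<in> f +o M" using l_idealD(1)[OF I] by (force simp: elt_set_plus_def)
  ultimately obtain m where "m \<in> M" "f = g + m" by (auto simp: elt_set_plus_def)
  then show "f - g \<in> M" by simp
next
  have "f +o M \<subseteq> g +o M" if "f - g \<in> M" for f g
  proof
    fix x assume "x \<in> f +o M"
    then obtain m where "m \<in> M" "x = f + m" by (auto simp: elt_set_plus_def)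
    then have "x = g + ((f - g) + m)" "(f - g) + m \<in> M" using that I by (auto intro: l_idealD(3))
    then show "x \<in> g +o M" unfolding elt_set_plus_def by blast
  qed
  moreover assume "f - g \<in> M"
  moreover from this have "g - f \<in> M" using l_idealD(2)[OF I] by fastforce
  ultimately show "f +o M = g +o M" by blast
qed

lemma quotient_embedding_inj:
  "quotient_embedding u M e \<Longrightarrow> e (f +o M) = e (g +o M) \<longleftrightarrow> f +o M = g +o M"
  unfolding quotient_embedding_def by (intro inj_on_eq_iff) auto

section \<open>The Yosida values at members of YG\<close>

context
  fixes u :: "'a::lattice_ab_group_add_abs"
  assumes W: "W_star u"
begin

lemma unit_nonneg: "0 \<le> u"
  using W unfolding W_star_def strong_unit_def by blast

lemma unit_bound: obtains n where "\<bar>g\<bar> \<le> nmult n u"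
proof -
  have "g \<in> principal_ideal u" using W unfolding W_star_def strong_unit_def by blast
  then show ?thesis using that unit_nonneg unfolding principal_ideal_def by auto
qed

lemma l_ideal_unit:
  assumes "l_ideal I" "u \<in> I" shows "I = UNIV"
proof -
  have "g \<in> I" for g
  proof -
    obtain n where "\<bar>g\<bar> \<le> nmult n u" by (rule unit_bound)
    then show ?thesis by (rule l_ideal_abs_le[OF assms(1) l_ideal_nmult[OF assms]])
  qed
  then show ?thesis by blast
qed

text \<open>Since \<open>u\<close> is a strong unit, an ideal is proper exactly when it misses
  \<open>u\<close>.\<close>

lemma yosida_space_eq: "yosida_space u = Collect maximal_ideal"
  unfolding yosida_space_def maximal_ideal_def using l_ideal_unit by blast

text \<open>The predicate says that x + M \<le> 0 in G/M. Totality is primeness of \<open>M\<close>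
  applied to the disjoint elements \<open>pprt x\<close> and \<open>pprt (- x)\<close>; the
  Archimedean condition comes from maximality.\<close>

lemma total_cone_pprt:
  assumes M: "M \<in> yosida_space u"
  shows "total_cone (\<lambda>x. pprt x \<in> M) u"
proof
  note I = yosida_spaceD(1)[OF M]
  show "pprt (x + y) \<in> M" if "pprt x \<in> M" "pprt y \<in> M" for x y
    by (rule l_ideal_between_0[OF I l_idealD(3)[OF I that] zero_le_pprt pprt_add_le])
  show total: "pprt x \<in> M \<or> pprt (- x) \<in> M" for x
    using yosida_space_prime[OF M, of "pprt x" "pprt (- x)"] l_idealD(1)[OF I]
    by (simp add: inf_pprt_uminus)
  show "\<exists>n. pprt (x - nmult n u) \<in> M" for x
  proof -
    obtain n where "\<bar>x\<bar> \<le> nmult n u" by (rule unit_bound)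
    then have "x - nmult n u \<le> 0" using order_trans[OF abs_ge_self] by simp
    then show ?thesis using l_idealD(1)[OF I] by (intro exI[of _ n]) simp
  qed
  show "pprt u \<notin> M" using yosida_spaceD(2)[OF M] unit_nonneg by simp
  fix x assume x: "pprt x \<notin> M"
  then obtain m n where m: "m \<in> M" "\<bar>u\<bar> \<le> m + nmult n \<bar>pprt x\<bar>"
    by (rule yosida_space_adjoin[OF M])
  \<comment> \<open>Hence \<open>pprt x\<close> and \<open>x\<close> agree modulo \<open>M\<close>,
    and the bound on \<open>u\<close> by a multiple of \<open>pprt x\<close> becomes one by a
    multiple of \<open>x\<close>.\<close>
  have "pprt (- x) \<in> M" using total x by blast
  then have M': "\<bar>m\<bar> + nmult n (pprt (- x)) \<in> M"
    by (intro l_idealD(3) I l_ideal_nmult l_ideal_abs m)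
  have "nmult n (pprt x) = nmult n (x + pprt (- x))"
    using pprt_diff_pprt_uminus[of x] by (simp only: diff_eq_eq)
  also have "\<dots> = nmult n x + nmult n (pprt (- x))" by (rule sum.distrib)
  finally have "u \<le> m + (nmult n x + nmult n (pprt (- x)))" using m unit_nonneg by simp
  also have "\<dots> \<le> \<bar>m\<bar> + (nmult n x + nmult n (pprt (- x)))"
    by (intro add_right_mono abs_ge_self)
  finally have "u - nmult n x \<le> \<bar>m\<bar> + nmult n (pprt (- x))" by (simp add: algebra_simps)
  then have "pprt (u - nmult n x) \<le> pprt (\<bar>m\<bar> + nmult n (pprt (- x)))" by (rule pprt_mono)
  also have "\<dots> = \<bar>m\<bar> + nmult n (pprt (- x))"
    by (intro pprt_eq_id add_nonneg_nonneg nmult_nonneg) auto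
  finally show "\<exists>n. pprt (u - nmult n x) \<in> M"
    by (intro exI) (rule l_ideal_between_0[OF I M' zero_le_pprt])
qed

text \<open>These are the hypotheses of \<open>additive_unique\<close> for the map sending
  \<open>x\<close> to \<open>e (x +o M)\<close>.\<close>

lemma quotient_embedding_additive:
  assumes M: "M \<in> yosida_space u" and e: "quotient_embedding u M e"
  shows "e ((f + g) +o M) = e (f +o M) + e (g +o M)" "e (u +o M) = 1"
    "e (x +o M) \<le> 0 \<longleftrightarrow> pprt x \<in> M"
proof -
  note I = yosida_spaceD(1)[OF M]
  show add: "e ((f + g) +o M) = e (f +o M) + e (g +o M)" for f g
    using e unfolding quotient_embedding_def by blast
  show "e (u +o M) = 1" using e unfolding quotient_embedding_def by blast
  have 0: "e (0 +o M) = 0" using add[of 0 0] by simp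
  have "pprt x \<in> M \<longleftrightarrow> pprt x +o M = 0 +o M" using coset_eq_iff[OF I, of "pprt x" 0] by simp
  also have "\<dots> \<longleftrightarrow> e (pprt x +o M) = e (0 +o M)" by (simp only: quotient_embedding_inj[OF e])
  also have "e (pprt x +o M) = max (e (x +o M)) (e (0 +o M))"
    using e unfolding quotient_embedding_def pprt_def by blast
  finally show "e (x +o M) \<le> 0 \<longleftrightarrow> pprt x \<in> M" unfolding 0 by (simp add: max_def)
qed

text \<open>The Hoelder value \<open>val\<close> has kernel \<open>M\<close>, so it factors
  injectively through G/M. It respects positive parts, hence suprema by sup f g = g + pprt (f - g),
  and then infima by f + g = sup f g + inf f g.\<close>

lemma ex_quotient_embedding:
  assumes M: "M \<in> yosida_space u"
  obtains e where "quotient_embedding u M e"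
proof -
  note I = yosida_spaceD(1)[OF M]
  interpret total_cone "\<lambda>x. pprt x \<in> M" u by (rule total_cone_pprt[OF M])
  have diff: "val (f - g) = val f - val g" for f g
    using val_add[of "f - g" g] by simp
  have zero: "val f = 0 \<longleftrightarrow> f \<in> M" for f
    using val_nonpos_iff[of f] val_nonpos_iff[of "- f"] mem_iff_pprt[OF I, of f]
    by (auto simp: val_minus)
  have eq: "f +o M = g +o M \<longleftrightarrow> val f = val g" for f g
    using coset_eq_iff[OF I, of f g] zero[of "f - g"] diff[of f g] by simp
  have pprt: "val (pprt x) = max (val x) 0" for x
  proof (cases "pprt x \<in> M")
    case True
    then show ?thesis using zero[of "pprt x"] val_nonpos_iff[of x] by simp
  next
    case False
    then have "pprt (- x) \<in> M" using P_total by blast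
    moreover have "pprt x = x + pprt (- x)"
      using pprt_diff_pprt_uminus[of x] by (simp only: diff_eq_eq)
    ultimately have "val (pprt x) = val x" using zero val_add by simp
    with False show ?thesis using val_nonpos_iff[of x] by simp
  qed
  have sup: "val (sup f g) = max (val f) (val g)" for f g
  proof -
    have "sup f g = g + pprt (f - g)" by (simp add: pprt_def add_sup_distrib_left)
    then show ?thesis using val_add pprt[of "f - g"] diff[of f g] by simp
  qed
  have inf: "val (inf f g) = min (val f) (val g)" for f g
  proof -
    have "f + g = sup f g + inf f g" by (rule add_eq_inf_sup)
    then show ?thesis using val_add[of f g] val_add[of "sup f g" "inf f g"] sup[of f g] by simp
  qed
  \<comment> \<open>On a coset the value does not depend on the chosen representative, by
    \<open>eq\<close>.\<close>
  define e where "e X = val (SOME g. X = g +o M)" for X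
  have e: "e (g +o M) = val g" for g
    unfolding e_def eq[symmetric] by (rule someI2[of _ g]) auto
  have "quotient_embedding u M e"
    unfolding quotient_embedding_def inj_on_def by (simp add: e val_add sup inf val_u eq)
  then show ?thesis by (rule that)
qed

text \<open>Existence and uniqueness of the embedding make the definite description meaningful;
  injectivity of the embedding then identifies its kernel.\<close>

lemma yosida_value_eq_0_iff:
  assumes M: "M \<in> yosida_space u"
  shows "yosida_value u g M = 0 \<longleftrightarrow> g \<in> M"
proof -
  note I = yosida_spaceD(1)[OF M]
  obtain e where e: "quotient_embedding u M e" using ex_quotient_embedding[OF M] .
  interpret total_cone "\<lambda>x. pprt x \<in> M" u by (rule total_cone_pprt[OF M])
  have "e' (g +o M) = e (g +o M)" if e': "quotient_embedding u M e'" for e'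
    using additive_unique[of "\<lambda>x. e' (x +o M)" "\<lambda>x. e (x +o M)"]
      quotient_embedding_additive[OF M e'] quotient_embedding_additive[OF M e]
    by (meson fun_cong)
  then have *: "yosida_value u g M = e (g +o M)"
    unfolding yosida_value_def using e by (intro the_equality) blast+
  have "e (0 +o M) = 0" using quotient_embedding_additive(1)[OF M e, of 0 0] by simp
  moreover have "e (g +o M) = e (0 +o M) \<longleftrightarrow> g +o M = 0 +o M"
    by (rule quotient_embedding_inj[OF e])
  ultimately show ?thesis using * coset_eq_iff[OF I, of g 0] by simp
qed

section \<open>Cozero sets, polars and the hull-kernel topology\<close>

lemma coz_eq: "coz u g = {M \<in> yosida_space u. g \<notin> M}"
  unfolding coz_def using yosida_value_eq_0_iff by blast

lemma vanishing_ideal_eq: "vanishing_ideal u (zero_set u g) = {f. coz u f \<subseteq> coz u g}"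
  unfolding vanishing_ideal_def zero_set_def coz_def by blast

lemma openin_coz: "openin (yosida_topology u) (coz u g)"
proof -
  have "coz u g = {M \<in> yosida_space u. \<not> {g} \<subseteq> M}" unfolding coz_eq by blast
  then show ?thesis unfolding openin_yosida_topology by blast
qed

lemma openin_yosida_base:
  assumes "openin (yosida_topology u) T" "M \<in> T"
  obtains h where "M \<in> coz u h" "coz u h \<subseteq> T"
  using assms unfolding openin_yosida_topology coz_eq by blast

text \<open>If \<open>g\<close> is nonzero, some n|g| is not below \<open>u\<close>, so the positive
  part \<open>t\<close> of n|g| - u is nonzero. The positive part \<open>s\<close> of u - n|g| is
  disjoint from \<open>t\<close>, so it generates an ideal missing \<open>u\<close>. A member of YG
  above that ideal contains \<open>s\<close> and, by assumption, \<open>g\<close>; as u \<le> n|g| +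
  s, it would contain \<open>u\<close>.\<close>

lemma Inter_yosida_space:
  assumes "\<And>M. M \<in> yosida_space u \<Longrightarrow> g \<in> M" shows "g = 0"
proof (rule ccontr)
  assume "g \<noteq> 0"
  moreover have "archimedean TYPE('a)" using W unfolding W_star_def by blast
  ultimately have "\<not> (\<forall>n. nmult n \<bar>g\<bar> \<le> u)"
    using unit_nonneg unfolding archimedean_def by (metis abs_ge_zero abs_eq_0)
  then obtain n where n: "\<not> nmult n \<bar>g\<bar> \<le> u" by blast
  define s t where "s = pprt (- (nmult n \<bar>g\<bar> - u))" and "t = pprt (nmult n \<bar>g\<bar> - u)"
  have st: "inf t s = 0" "0 \<le> s" "0 \<le> t"
    unfolding s_def t_def by (auto simp only: inf_pprt_uminus zero_le_pprt)
  have "nmult n \<bar>g\<bar> - u \<le> t" unfolding t_def pprt_def by simp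
  with n have t0: "t \<noteq> 0" by auto
  \<comment> \<open>The principal ideal of \<open>s\<close>, written as the zero ideal with
    \<open>s\<close> adjoined so that \<open>l_ideal_adjoin\<close> applies.\<close>
  let ?J = "{x. \<exists>m\<in>{0}. \<exists>k. \<bar>x\<bar> \<le> m + nmult k \<bar>s\<bar>}"
  have "u \<notin> ?J"
  proof
    assume "u \<in> ?J"
    then obtain k where k: "u \<le> nmult k s" using st unit_nonneg by auto
    \<comment> \<open>Disjointness of \<open>t\<close> from \<open>s\<close> passes to
      \<open>u\<close>, which lies below a multiple of \<open>s\<close>, and then to
      \<open>t\<close> itself, which lies below a multiple of \<open>u\<close>; so \<open>t\<close>
      would vanish.\<close>
    have "inf t u \<le> inf t (nmult k s)" using k by (rule inf_mono[OF order_refl])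
    also have "\<dots> \<le> nmult k (inf t s)" using st by (intro inf_nmult_le)
    finally have tu: "inf t u = 0"
      using st unit_nonneg by (simp add: antisym)
    obtain j where "\<bar>t\<bar> \<le> nmult j u" by (rule unit_bound)
    then have "t = inf t (nmult j u)" using st by (simp add: inf_absorb1)
    also have "\<dots> \<le> nmult j (inf t u)" using st unit_nonneg by (intro inf_nmult_le)
    finally show False using tu t0 st by simp
  qed
  then obtain M where M: "M \<in> yosida_space u" "?J \<subseteq> M"
    using ex_yosida_space_superset[OF l_ideal_adjoin[OF l_ideal_zero]] by blast
  note I = yosida_spaceD(1)[OF M(1)]
  have "s \<in> ?J" by (auto intro!: exI[of _ 1])
  then have "nmult n \<bar>g\<bar> + s \<in> M"
    using M assms by (intro l_idealD(3)[OF I] l_ideal_nmult[OF I] l_ideal_abs[OF I]) auto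
  moreover have "u \<le> nmult n \<bar>g\<bar> + s"
  proof -
    have "u - nmult n \<bar>g\<bar> \<le> s" unfolding s_def pprt_def by simp
    then show ?thesis by (simp only: diff_le_eq add.commute)
  qed
  ultimately have "u \<in> M" using l_ideal_between_0[OF I _ unit_nonneg] by blast
  then show False using yosida_spaceD(2)[OF M(1)] by blast
qed

text \<open>Primeness of the members of YG gives one direction; the other holds because their
  intersection is zero.\<close>

lemma polar_iff: "f \<in> polar g \<longleftrightarrow> coz u f \<inter> coz u g = {}"
proof
  assume "f \<in> polar g"
  then have "inf \<bar>f\<bar> \<bar>g\<bar> \<in> M" if "M \<in> yosida_space u" for M
    using l_idealD(1)[OF yosida_spaceD(1)[OF that]] by (simp add: polar_def)
  then show "coz u f \<inter> coz u g = {}" unfolding coz_eq using yosida_space_prime by blast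
next
  assume disj: "coz u f \<inter> coz u g = {}"
  have "inf \<bar>f\<bar> \<bar>g\<bar> \<in> M" if M: "M \<in> yosida_space u" for M
  proof -
    note I = yosida_spaceD(1)[OF M]
    have "\<bar>f\<bar> \<in> M \<or> \<bar>g\<bar> \<in> M" using disj M l_ideal_abs[OF I] unfolding coz_eq by blast
    then show ?thesis using l_ideal_between_0[OF I]
      by (metis abs_ge_zero inf_greatest inf_le1 inf_le2)
  qed
  then show "f \<in> polar g" unfolding polar_def using Inter_yosida_space by blast
qed

text \<open>Membership says that \<open>coz u f\<close> misses every cozero set disjoint from
  \<open>coz u g\<close>. As cozero sets form a base, this places \<open>coz u f\<close> in the
  closure of \<open>coz u g\<close>.\<close>

lemma bipolar_iff:
  "f \<in> polar_set (polar g) \<longleftrightarrow>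
     coz u f \<subseteq> yosida_topology u interior_of (yosida_topology u closure_of coz u g)"
proof -
  have "f \<in> polar_set (polar g) \<longleftrightarrow>
      (\<forall>h. coz u h \<inter> coz u g = {} \<longrightarrow> coz u f \<inter> coz u h = {})"
    unfolding polar_set_def INT_iff Ball_def polar_iff by (rule refl)
  also have "\<dots> \<longleftrightarrow> coz u f \<subseteq> yosida_topology u closure_of coz u g" (is "?L \<longleftrightarrow> ?R")
  proof
    assume L: ?L
    show ?R
    proof
      fix M assume M: "M \<in> coz u f"
      show "M \<in> yosida_topology u closure_of coz u g"
        unfolding in_closure_of
      proof (intro conjI allI impI)
        show "M \<in> topspace (yosida_topology u)"
          using M unfolding topspace_yosida_topology coz_eq by blast
        fix T assume "M \<in> T \<and> openin (yosida_topology u) T"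
        then obtain h where "M \<in> coz u h" "coz u h \<subseteq> T" using openin_yosida_base by blast
        \<comment> \<open>If \<open>coz u h\<close> missed \<open>coz u g\<close>, it would also
          miss \<open>coz u f\<close>, yet both contain \<open>M\<close>.\<close>
        then show "\<exists>y. y \<in> coz u g \<and> y \<in> T" using L M by blast
      qed
    qed
  next
    assume R: ?R
    show ?L
    proof (intro allI impI)
      fix h assume "coz u h \<inter> coz u g = {}"
      then show "coz u f \<inter> coz u h = {}"
        using R openin_coz[of h] unfolding in_closure_of subset_iff by blast
    qed
  qed
  \<comment> \<open>An open set inside the closure already lies in its interior.\<close>
  also have "\<dots> \<longleftrightarrow>
      coz u f \<subseteq> yosida_topology u interior_of (yosida_topology u closure_of coz u g)"
    using openin_coz by (simp add: interior_of_maximal_eq)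
  finally show ?thesis .
qed

lemma coz_subset_interior_closure:
  "coz u g \<subseteq> yosida_topology u interior_of (yosida_topology u closure_of coz u g)"
  using openin_coz[of g] openin_subset[OF openin_coz[of g]]
  by (simp add: interior_of_maximal_eq closure_of_subset)

section \<open>Characterizing the classes (Y), (CR) and (M)\<close>

lemma principal_ideal_subset_vanishing_ideal:
  "principal_ideal g \<subseteq> vanishing_ideal u (zero_set u g)"
proof -
  have "f \<in> M" if f: "f \<in> principal_ideal g" and M: "M \<in> yosida_space u" "g \<in> M" for f M
  proof -
    note I = yosida_spaceD(1)[OF M(1)]
    obtain n where "\<bar>f\<bar> \<le> nmult n \<bar>g\<bar>" using f unfolding principal_ideal_def by blast
    then show ?thesis by (rule l_ideal_abs_le[OF I l_ideal_nmult[OF I l_ideal_abs[OF I M(2)]]])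
  qed
  then show ?thesis unfolding vanishing_ideal_eq coz_eq by blast
qed

lemma vanishing_ideal_subset_bipolar:
  "vanishing_ideal u (zero_set u g) \<subseteq> polar_set (polar g)"
  unfolding vanishing_ideal_eq subset_iff bipolar_iff using coz_subset_interior_closure by blast

text \<open>Any maximal ideals that intersect to G(g) all contain \<open>g\<close>, so their
  intersection contains I(Z(g)), the intersection of all maximal ideals containing \<open>g\<close>.
  Conversely, this full family witnesses (Y).\<close>

lemma class_Y_iff:
  "class_Y TYPE('a) \<longleftrightarrow> (\<forall>g. principal_ideal g = vanishing_ideal u (zero_set u g))"
proof
  assume Y: "class_Y TYPE('a)"
  show "\<forall>g. principal_ideal g = vanishing_ideal u (zero_set u g)"
  proof (intro allI antisym principal_ideal_subset_vanishing_ideal)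
    fix g :: 'a
    have "\<exists>\<M>. (\<forall>M\<in>\<M>. maximal_ideal M) \<and> principal_ideal g = \<Inter>\<M>"
      using Y unfolding class_Y_def by (rule spec)
    then obtain \<M> where \<M>: "\<And>M. M \<in> \<M> \<Longrightarrow> maximal_ideal M" "principal_ideal g = \<Inter>\<M>"
      by auto
    have g: "g \<in> \<Inter>\<M>"
      unfolding \<M>(2)[symmetric] principal_ideal_def by (auto intro!: exI[of _ 1])
    show "vanishing_ideal u (zero_set u g) \<subseteq> principal_ideal g"
      unfolding \<M>(2) vanishing_ideal_eq coz_eq yosida_space_eq using \<M>(1) g by auto
  qed
next
  assume *: "\<forall>g. principal_ideal g = vanishing_ideal u (zero_set u g)"
  show "class_Y TYPE('a)"
    unfolding class_Y_def
  proof
    fix g :: 'a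
    have "principal_ideal g = \<Inter>{M. maximal_ideal M \<and> g \<in> M}"
      using * unfolding vanishing_ideal_eq coz_eq yosida_space_eq by auto
    then show "\<exists>\<M>. (\<forall>M\<in>\<M>. maximal_ideal M) \<and> principal_ideal g = \<Inter>\<M>"
      by (intro exI conjI) auto
  qed
qed

text \<open>For the converse, the interior of the closure of \<open>coz u g\<close> is covered by
  cozero sets \<open>coz u h\<close> inside it. Each such \<open>h\<close> is in the bipolar of
  \<open>g\<close>, hence in I(Z(g)), so \<open>coz u h\<close> lies in
  \<open>coz u g\<close>.\<close>

lemma class_CR_iff:
  "class_CR u \<longleftrightarrow> (\<forall>g. vanishing_ideal u (zero_set u g) = polar_set (polar g))"
proof
  assume "class_CR u"
  then have eq: "coz u g = yosida_topology u interior_of (yosida_topology u closure_of coz u g)" for g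
    unfolding class_CR_def regular_openin_def by blast
  show "\<forall>g. vanishing_ideal u (zero_set u g) = polar_set (polar g)"
    by (intro allI set_eqI) (simp add: vanishing_ideal_eq bipolar_iff flip: eq)
next
  assume *: "\<forall>g. vanishing_ideal u (zero_set u g) = polar_set (polar g)"
  have "yosida_topology u interior_of (yosida_topology u closure_of coz u g) \<subseteq> coz u g" for g
  proof
    let ?T = "yosida_topology u interior_of (yosida_topology u closure_of coz u g)"
    fix M assume "M \<in> ?T"
    then obtain h where h: "M \<in> coz u h" "coz u h \<subseteq> ?T"
      using openin_yosida_base[OF openin_interior_of] by blast
    then have "h \<in> vanishing_ideal u (zero_set u g)" using * bipolar_iff by blast
    then show "M \<in> coz u g" using h unfolding vanishing_ideal_eq by blast
  qed
  then show "class_CR u"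
    unfolding class_CR_def regular_openin_def
    using coz_subset_interior_closure openin_subset[OF openin_coz] by blast
qed

text \<open>I(Z(g)) lies between G(g) and the bipolar of \<open>g\<close>, so the outer two agree
  exactly when both inclusions are equalities.\<close>

lemma class_M_iff: "class_M TYPE('a) \<longleftrightarrow> class_Y TYPE('a) \<and> class_CR u"
  unfolding class_Y_iff class_CR_iff class_M_def
  using principal_ideal_subset_vanishing_ideal vanishing_ideal_subset_bipolar by blast

end

theorem corollary1p6:
  fixes u :: "'a::lattice_ab_group_add_abs"
  assumes "W_star u"
  shows "(class_Y TYPE('a) \<longleftrightarrow>
            (\<forall>g. principal_ideal g = vanishing_ideal u (zero_set u g)))
       \<and> (class_CR u \<longleftrightarrow>
            (\<forall>g. vanishing_ideal u (zero_set u g) = polar_set (polar g)))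
       \<and> (class_M TYPE('a) \<longleftrightarrow> class_Y TYPE('a) \<and> class_CR u)"
  using class_Y_iff[OF assms] class_CR_iff[OF assms] class_M_iff[OF assms] by blast

end
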